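(* Let $n\ge 2$. For all $A,B_1,\dots,B_n,C\in\widehat{\mathbb{F}_q^\times}$ and all $\lambda_1,\dots,\lambda_n\in\mathbb{F}_q$, $$\mathbb{P}_D^{(n)}\left[\begin{matrix}A; & B_1\ \cdots\ B_n\\ & C\end{matrix};\lambda_1,\dots,\lambda_n\right]=A(-1)\,\mathbb{P}_D^{(n)}\left[\begin{matrix}A; & B_1\ \cdots\ B_n\\ & A\overline{C}B_1B_2\cdots B_n\end{matrix};1-\lambda_1,\dots,1-\lambda_n\right].$$
   Context: $\mathbb{F}_q$ is a finite field with $q=p^e$, $p$ an odd prime. $\widehat{\mathbb{F}_q^\times}$ is the group of complex-valued multiplicative characters of $\mathbb{F}_q^\times$; every character $\chi$, including the trivial one, is extended to $\mathbb{F}_q$ by $\chi(0)=0$, and $\overline{\chi}=\chi^{-1}$. The finite-field Appell-Lauricella period function is $$\mathbb{P}_D^{(n)}\left[\begin{matrix}A; & B_1\ \cdots\ B_n\\ & C\end{matrix};\lambda_1,\dots,\lambda_n\right]=\sum_{y\in\mathbb{F}_q}A(y)\,C\overline{A}(1-y)\,\overline{B_1}(1-\lambda_1y)\cdots\overline{B_n}(1-\lambda_ny).$$ *)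

theory Defs
  imports Complex_Main "HOL-Computational_Algebra.Primes" "HOL-Library.Cardinality"
    "HOL-Library.Function_Algebras" "HOL-Library.Function_Division"
begin

text \<open>
  A multiplicative character is a homomorphism from the nonzero elements of the field to
  the nonzero complex numbers. It is represented by its extension to the whole field with value 0
  at 0; this applies to the trivial character as well, which is therefore not the constant
  function 1.

  The product and the inverse of characters are the pointwise operations of
  \<open>Function_Algebras\<close> and \<open>Function_Division\<close>. Because \<open>inverse 0 = 0\<close> in \<open>complex\<close>,
  they respect the convention at 0.
\<close>

definition mult_chars :: "('a::field \<Rightarrow> complex) set" where
  "mult_chars = {\<chi>. \<chi> 0 = 0 \<and> (\<forall>x. x \<noteq> 0 \<longrightarrow> \<chi> x \<noteq> 0) \<and>
     (\<forall>x y. x \<noteq> 0 \<longrightarrow> y \<noteq> 0 \<longrightarrow> \<chi> (x * y) = \<chi> x * \<chi> y)}"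

lemma mult_chars_times: "\<chi> \<in> mult_chars \<Longrightarrow> \<psi> \<in> mult_chars \<Longrightarrow> \<chi> * \<psi> \<in> mult_chars"
  by (auto simp: mult_chars_def)

lemma mult_chars_inverse: "\<chi> \<in> mult_chars \<Longrightarrow> inverse \<chi> \<in> mult_chars"
  by (auto simp: mult_chars_def inverse_fun_def)

lemma mult_chars_trivial: "(\<lambda>x. if x = 0 then 0 else 1) \<in> mult_chars"
  by (auto simp: mult_chars_def)

text \<open>The characters \<open>B\<close> and the parameters \<open>l\<close> are indexed by \<open>1, \<dots>, n\<close>; values at other
  indices are irrelevant.\<close>

definition period_D ::
  "nat \<Rightarrow> ('a::{finite,field} \<Rightarrow> complex) \<Rightarrow> (nat \<Rightarrow> 'a \<Rightarrow> complex) \<Rightarrow> ('a \<Rightarrow> complex)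
    \<Rightarrow> (nat \<Rightarrow> 'a) \<Rightarrow> complex" where
  "period_D n A B C l =
     (\<Sum>y\<in>UNIV. A y * (C * inverse A) (1 - y) * (\<Prod>i=1..n. inverse (B i) (1 - l i * y)))"

end

(* The substitution y = z / (z - 1) is an involution of the field without 1. It turns 1 - y into
   1 / (1 - z) and 1 - (1 - l) y into (1 - l z) / (1 - z), so multiplicativity transforms the
   summands of the two sums into each other. The point 1 contributes 0 on both sides because
   characters vanish at 0. *)
theory Submission
  imports Defs
begin

text \<open>With the value 0 at 0, the product rule survives zero arguments: both sides vanish.
  Factors such as \<open>1 - l i * z\<close> may therefore be 0 later without a case split.\<close>

lemma mult_charsD:
  assumes "\<chi> \<in> mult_chars"
  shows mult_chars_zero: "\<chi> 0 = 0"
    and mult_chars_nonzero: "x \<noteq> 0 \<Longrightarrow> \<chi> x \<noteq> 0"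
    and mult_chars_mult: "\<chi> (x * y) = \<chi> x * \<chi> y"
  using assms by (auto simp: mult_chars_def) (metis mult_zero_left mult_zero_right)

lemma mult_chars_one:
  assumes "\<chi> \<in> mult_chars"
  shows "\<chi> 1 = 1"
  using mult_chars_mult[OF assms, of 1 1] mult_chars_nonzero[OF assms, of 1] by simp

lemma mult_chars_inverse_arg:
  assumes "\<chi> \<in> mult_chars"
  shows "\<chi> (inverse x) = inverse (\<chi> x)"
proof (cases "x = 0")
  case False
  then have "\<chi> x * \<chi> (inverse x) = 1"
    using mult_chars_mult[OF assms, of x "inverse x"] by (simp add: mult_chars_one[OF assms])
  then show ?thesis by (simp add: inverse_unique)
qed (simp add: mult_chars_zero[OF assms])

lemma mult_chars_divide:
  assumes "\<chi> \<in> mult_chars"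
  shows "\<chi> (x / y) = \<chi> x / \<chi> y"
  by (simp add: divide_inverse mult_chars_mult[OF assms] mult_chars_inverse_arg[OF assms])

lemma mult_chars_minus:
  assumes "\<chi> \<in> mult_chars"
  shows "\<chi> (- x) = \<chi> (-1) * \<chi> x"
  using mult_chars_mult[OF assms, of "-1" x] by simp

lemma mult_chars_minus_one_square:
  assumes "\<chi> \<in> mult_chars"
  shows "\<chi> (-1) * \<chi> (-1) = 1"
  using mult_chars_mult[OF assms, of "-1" "-1"] by (simp add: mult_chars_one[OF assms])

lemma prod_fun_apply:
  fixes f :: "'i \<Rightarrow> 'a \<Rightarrow> 'b::comm_monoid_mult"
  shows "(\<Prod>i\<in>I. f i) x = (\<Prod>i\<in>I. f i x)"
  by (induction I rule: infinite_finite_induct) auto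

text \<open>The values at \<open>1 - z\<close> balance. \<open>A y\<close> supplies
  \<open>inverse (A (1 - z))\<close>; in the middle factor \<open>A\<close> cancels, leaving
  \<open>C (1 - z)\<close> divided by all \<open>B i (1 - z)\<close>; the last product returns those
  \<open>B i (1 - z)\<close>. This balance dictates the new lower parameter.\<close>

lemma period_D_summand:
  fixes l :: "nat \<Rightarrow> 'a::field"
  assumes A: "A \<in> mult_chars" and C: "C \<in> mult_chars"
    and B: "\<And>i. i \<in> {1..n} \<Longrightarrow> B i \<in> mult_chars"
    and z: "z \<noteq> 1"
  defines "y \<equiv> z / (z - 1)"
  shows "A (-1) * (A y * ((A * inverse C * (\<Prod>i=1..n. B i)) * inverse A) (1 - y) *
      (\<Prod>i=1..n. inverse (B i) (1 - (1 - l i) * y))) =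
    A z * (C * inverse A) (1 - z) * (\<Prod>i=1..n. inverse (B i) (1 - l i * z))"
proof -
  have nz: "1 - z \<noteq> 0" "z - 1 \<noteq> 0" using z by auto
  have y: "y = - (z / (1 - z))" "1 - y = inverse (1 - z)"
    and yl: "1 - (1 - k) * y = (1 - k * z) / (1 - z)" for k
    using nz by (simp_all add: y_def field_simps)
  note nonzero = mult_chars_nonzero[OF A nz(1)] mult_chars_nonzero[OF C nz(1)]
  have prodB: "(\<Prod>i=1..n. B i (1 - z)) \<noteq> 0"
    using mult_chars_nonzero[OF B nz(1)] by simp
  \<comment> \<open>\<open>b\<close> collects what the denominators \<open>1 - z\<close> in
    \<open>yl\<close> contribute; \<open>P\<close> is the part that survives.\<close>
  define P b where "P = (\<Prod>i=1..n. inverse (B i) (1 - l i * z))"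
    and "b = (\<Prod>i=1..n. B i (1 - z))"
  have b: "b \<noteq> 0"
    using prodB by (simp add: b_def)
  have Pb: "(\<Prod>i=1..n. inverse (B i) (1 - (1 - l i) * y)) = b * P"
    unfolding yl b_def P_def prod.distrib[symmetric]
    by (rule prod.cong) (simp_all add: mult_chars_divide[OF B] divide_inverse[of _ "B _ _"])
  have By: "(\<Prod>i=1..n. B i) (1 - y) = inverse b"
    unfolding y(2) b_def prod_fun_apply prod_inversef[symmetric] o_def
    by (rule prod.cong) (simp_all add: mult_chars_inverse_arg[OF B])
  have Ay: "A y = A (-1) * (A z / A (1 - z))"
    unfolding y(1) using mult_chars_minus[OF A] mult_chars_divide[OF A] by metis
  have ACy: "A (1 - y) = inverse (A (1 - z))" "C (1 - y) = inverse (C (1 - z))"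
    by (simp_all add: y(2) mult_chars_inverse_arg A C)
  \<comment> \<open>The second \<open>A (-1)\<close> comes from the sign in
    \<open>y = - (z / (1 - z))\<close>; the two multiply to 1.\<close>
  have "A (-1) * (A y * ((A * inverse C * (\<Prod>i=1..n. B i)) * inverse A) (1 - y) * (b * P)) =
      (A (-1) * A (-1)) * (A z * (C * inverse A) (1 - z) * P)"
    unfolding times_fun_apply inverse_fun_apply By Ay ACy
    using nonzero b by (simp add: divide_simps)
  then show ?thesis
    unfolding Pb P_def[symmetric] mult_chars_minus_one_square[OF A] by simp
qed

theorem proposition6p2:
  fixes A C :: "'a::{finite,field} \<Rightarrow> complex"
    and B :: "nat \<Rightarrow> 'a \<Rightarrow> complex"
    and l :: "nat \<Rightarrow> 'a"
    and n p e :: nat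
  assumes "prime p" and "odd p" and "CARD('a) = p ^ e"
    and "n \<ge> 2"
    and "A \<in> mult_chars" and "C \<in> mult_chars"
    and "\<And>i. i \<in> {1..n} \<Longrightarrow> B i \<in> mult_chars"
  shows "period_D n A B C l =
    A (-1) * period_D n A B (A * inverse C * (\<Prod>i=1..n. B i)) (\<lambda>i. 1 - l i)"
proof -
  define L where "L z = A z * (C * inverse A) (1 - z) * (\<Prod>i=1..n. inverse (B i) (1 - l i * z))"
    for z
  define R where "R y = A y * ((A * inverse C * (\<Prod>i=1..n. B i)) * inverse A) (1 - y) *
      (\<Prod>i=1..n. inverse (B i) (1 - (1 - l i) * y))" for y
  \<comment> \<open>The middle factor is evaluated at 0, where even a trivial character such as
    \<open>C * inverse A\<close> with \<open>A = C\<close> gives 0.\<close>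
  have L1: "L 1 = 0" and R1: "R 1 = 0"
    by (simp_all add: L_def R_def mult_chars_zero assms(5,6))
  have "period_D n A B C l = (\<Sum>z\<in>UNIV. L z)"
    by (simp add: period_D_def L_def)
  also have "\<dots> = (\<Sum>z\<in>UNIV - {1}. L z)"
    using L1 by (simp add: sum.remove[of UNIV 1])
  also have "\<dots> = (\<Sum>y\<in>UNIV - {1}. A (-1) * R y)"
  \<comment> \<open>An involution serves as its own inverse witness. Since \<open>1 / 0 = 0\<close>,
    the point 1 would collide with 0, hence its removal beforehand.\<close>
  proof (rule sum.reindex_bij_witness[of _ "\<lambda>y. y / (y - 1)" "\<lambda>z. z / (z - 1)"])
    fix z :: 'a
    assume "z \<in> UNIV - {1}"
    then show "A (-1) * R (z / (z - 1)) = L z"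
      unfolding L_def R_def by (intro period_D_summand assms(5-7)) auto
  qed (simp_all add: divide_simps)
  also have "\<dots> = A (-1) * (\<Sum>y\<in>UNIV. R y)"
    using R1 by (simp add: sum_distrib_left[symmetric] sum.remove[of UNIV 1])
  finally show ?thesis
    by (simp add: period_D_def R_def)
qed

end
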